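(* Let $s,t\in\mathbb{T}$ be such that $s\leq t$. Then $$\int_{\mathbb{T}}1_{]s,t]}(u)\,d_\Delta W_u=W_{t+\bar\mu_g(t)}-W_{s+\bar\mu_g(s)},\quad\mu_{\mathbb{T}}\text{-a.s.},$$ where $\bar\mu_g$ denotes the graininess function of the time scale $\mathbb{T}$.
   Context: $\mathbb{T}$ is a closed subset of $\mathbb{R}$ with $\{0,1\}\subset\mathbb{T}\subset[0,1]$; for an interval $I\subset[0,1]$, $I_{\mathbb{T}}:=I\cap\mathbb{T}$. Let $\bar\sigma(t):=\inf\{u\in\mathbb{T}:u>t\}$ for $t\in[0,1)$, $\bar\sigma(1):=1$; the graininess is $\bar\mu_g(t):=\bar\sigma(t)-t$, $t\in\mathbb{T}$. Let $\bar\rho:[0,1]\to\mathbb{T}$ be $\bar\rho(t):=\sup\{u\in\mathbb{T}:u<t\}$ for $t\in(0,1]$ and $\bar\rho(0):=0$; $\lambda_\Delta:=\bar\rho_\star\lambda$ is the pushforward to $(\mathbb{T},\mathcal{B}(\mathbb{T}))$ of Lebesgue measure $\lambda$ on $[0,1]$. $C_{\mathbb{T}}$ is the Banach space of continuous $\omega:\mathbb{T}\to\mathbb{R}$ with $\omega(0)=0$, with the sup norm; $W_t(\omega):=\omega(t)$ is evaluation. $\mu_{\mathbb{T}}$ is the law on $C_{\mathbb{T}}$ of $(B_t)_{t\in\mathbb{T}}$, where $(B_t)_{t\in[0,1]}$ is a standard Brownian motion started at $0$. $H_{\mathbb{T}}$ is the separable Hilbert space of $h\in C_{\mathbb{T}}$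 of the form $h(t)=\int_{[0,t)_{\mathbb{T}}}h^\Delta(s)\lambda_\Delta(ds)$, $t\in\mathbb{T}$, with $h^\Delta\in L^2(\lambda_\Delta)$, with scalar product $\langle h,k\rangle_{H_{\mathbb{T}}}=\int_{\mathbb{T}}h^\Delta k^\Delta\,d\lambda_\Delta$. For $l$ in the topological dual $C_{\mathbb{T}}^\star$, $j^{\mathbb{T}}(l)\in H_{\mathbb{T}}$ is the unique element with $\langle j^{\mathbb{T}}(l),h\rangle_{H_{\mathbb{T}}}=\langle l,h\rangle_{C_{\mathbb{T}}^\star,C_{\mathbb{T}}}$ for all $h\in H_{\mathbb{T}}$. The map $\mathcal{I}:j^{\mathbb{T}}(C_{\mathbb{T}}^\star)\to L^2(\mu_{\mathbb{T}})$, $\mathcal{I}(j^{\mathbb{T}}(l))(\omega)=\langle l,\omega\rangle_{C_{\mathbb{T}}^\star,C_{\mathbb{T}}}$ $\mu_{\mathbb{T}}$-a.s., is a linear isometry with dense domain in $H_{\mathbb{T}}$, hence extends uniquely to an isometry $\mathcal{I}:H_{\mathbb{T}}\to L^2(\mu_{\mathbb{T}})$ (the Paley-Wiener integral), and one writes $\int_{\mathbb{T}}h^\Delta(s)\,d_\Delta W_s:=\mathcal{I}(h)$ for $h\in H_{\mathbb{T}}$. *)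

theory Defs
  imports "HOL-Probability.Probability"
begin

section \<open>Time scales\<close>

definition fwd_jump :: "real set \<Rightarrow> real \<Rightarrow> real" where
  "fwd_jump T t = (if t < 1 then Inf {u \<in> T. t < u} else 1)"

definition graininess :: "real set \<Rightarrow> real \<Rightarrow> real" where
  "graininess T t = fwd_jump T t - t"

definition bwd_jump :: "real set \<Rightarrow> real \<Rightarrow> real" where
  "bwd_jump T t = (if 0 < t then Sup {u \<in> T. u < t} else 0)"

definition delta_measure :: "real set \<Rightarrow> real measure" where
  "delta_measure T =
     distr (restrict_space lborel {0..1}) (restrict_space borel T) (bwd_jump T)"


section \<open>The Banach space of continuous paths and its dual\<close>

text \<open>A function on \<^term>\<open>T\<close> is represented by its extension by \<open>0\<close> to the whole line.
  This makes the representation unique and stable under pointwise linear operations.\<close>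

definition path_space :: "real set \<Rightarrow> (real \<Rightarrow> real) set" where
  "path_space T = {\<omega>. continuous_on T \<omega> \<and> \<omega> 0 = 0 \<and> (\<forall>t. t \<notin> T \<longrightarrow> \<omega> t = 0)}"

definition sup_norm :: "real set \<Rightarrow> (real \<Rightarrow> real) \<Rightarrow> real" where
  "sup_norm T \<omega> = (SUP t\<in>T. \<bar>\<omega> t\<bar>)"

definition path_topology :: "real set \<Rightarrow> (real \<Rightarrow> real) topology" where
  "path_topology T =
     Metric_space.mtopology (path_space T) (\<lambda>\<omega> \<eta>. sup_norm T (\<lambda>t. \<omega> t - \<eta> t))"

definition path_borel :: "real set \<Rightarrow> (real \<Rightarrow> real) measure" where
  "path_borel T = sigma (path_space T) {U. openin (path_topology T) U}"

text \<open>Only the values of a functional on \<^term>\<open>path_space T\<close> are relevant;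
  the dual pairing is application.\<close>

definition path_dual :: "real set \<Rightarrow> ((real \<Rightarrow> real) \<Rightarrow> real) set" where
  "path_dual T = {l.
     (\<forall>\<omega>\<in>path_space T. \<forall>\<eta>\<in>path_space T. l (\<lambda>t. \<omega> t + \<eta> t) = l \<omega> + l \<eta>) \<and>
     (\<forall>c. \<forall>\<omega>\<in>path_space T. l (\<lambda>t. c * \<omega> t) = c * l \<omega>) \<and>
     (\<exists>K. \<forall>\<omega>\<in>path_space T. \<bar>l \<omega>\<bar> \<le> K * sup_norm T \<omega>)}"

definition W :: "real \<Rightarrow> (real \<Rightarrow> real) \<Rightarrow> real" where
  "W t \<omega> = \<omega> t"


section \<open>Brownian motion and its law on the path space\<close>

locale standard_brownian_motion = prob_space M
  for M :: "'a measure" and B :: "real \<Rightarrow> 'a \<Rightarrow> real" +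
  assumes measurable_B: "\<And>t. t \<in> {0..1} \<Longrightarrow> random_variable borel (B t)"
    and start: "\<And>x. x \<in> space M \<Longrightarrow> B 0 x = 0"
    and continuous_paths: "\<And>x. x \<in> space M \<Longrightarrow> continuous_on {0..1} (\<lambda>t. B t x)"
    and gaussian_increments:
      "\<And>s t. 0 \<le> s \<Longrightarrow> s < t \<Longrightarrow> t \<le> 1 \<Longrightarrow>
         distributed M lborel (\<lambda>x. B t x - B s x) (normal_density 0 (sqrt (t - s)))"
    and indep_increments:
      "\<And>(n::nat) \<tau>. strict_mono_on {..n} \<tau> \<Longrightarrow> \<tau> ` {..n} \<subseteq> {0..1} \<Longrightarrow>
         indep_vars (\<lambda>_. borel) (\<lambda>i x. B (\<tau> (Suc i)) x - B (\<tau> i) x) {..<n}"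

definition path_law ::
    "real set \<Rightarrow> 'a measure \<Rightarrow> (real \<Rightarrow> 'a \<Rightarrow> real) \<Rightarrow> (real \<Rightarrow> real) measure" where
  "path_law T M B = distr M (path_borel T) (\<lambda>x t. if t \<in> T then B t x else 0)"


section \<open>The Cameron-Martin space\<close>

definition L2 :: "'b measure \<Rightarrow> ('b \<Rightarrow> real) set" where
  "L2 N = {f \<in> borel_measurable N. integrable N (\<lambda>x. (f x)\<^sup>2)}"

definition delta_primitive :: "real set \<Rightarrow> (real \<Rightarrow> real) \<Rightarrow> real \<Rightarrow> real" where
  "delta_primitive T f t =
     (if t \<in> T then (LINT u:({0..<t} \<inter> T)|delta_measure T. f u) else 0)"

definition CM_space :: "real set \<Rightarrow> (real \<Rightarrow> real) set" where
  "CM_space T = {h \<in> path_space T. \<exists>f \<in> L2 (delta_measure T). h = delta_primitive T f}"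

text \<open>A representative of the derivative, which is determined almost everywhere.\<close>

definition delta_deriv :: "real set \<Rightarrow> (real \<Rightarrow> real) \<Rightarrow> real \<Rightarrow> real" where
  "delta_deriv T h = (SOME f. f \<in> L2 (delta_measure T) \<and> h = delta_primitive T f)"

definition CM_inner :: "real set \<Rightarrow> (real \<Rightarrow> real) \<Rightarrow> (real \<Rightarrow> real) \<Rightarrow> real" where
  "CM_inner T h k = (LINT u|delta_measure T. delta_deriv T h u * delta_deriv T k u)"

definition CM_embed :: "real set \<Rightarrow> ((real \<Rightarrow> real) \<Rightarrow> real) \<Rightarrow> real \<Rightarrow> real" where
  "CM_embed T l = (THE g. g \<in> CM_space T \<and> (\<forall>h\<in>CM_space T. CM_inner T g h = l h))"


section \<open>The Paley-Wiener integral\<close>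

text \<open>Elements of the space of square integrable random variables are given by representatives,
  so linearity and the extension property hold almost surely. Because the range of
  \<^term>\<open>CM_embed T\<close> is dense in \<^term>\<open>CM_space T\<close>, these properties determine \<^term>\<open>I\<close> up to
  almost sure equality.\<close>

definition paley_wiener ::
    "real set \<Rightarrow> (real \<Rightarrow> real) measure \<Rightarrow> ((real \<Rightarrow> real) \<Rightarrow> (real \<Rightarrow> real) \<Rightarrow> real) \<Rightarrow> bool" where
  "paley_wiener T \<mu> I \<longleftrightarrow>
     (\<forall>h\<in>CM_space T. I h \<in> L2 \<mu>) \<and>
     (\<forall>h\<in>CM_space T. \<forall>k\<in>CM_space T. AE \<omega> in \<mu>. I (\<lambda>t. h t + k t) \<omega> = I h \<omega> + I k \<omega>) \<and>
     (\<forall>c. \<forall>h\<in>CM_space T. AE \<omega> in \<mu>. I (\<lambda>t. c * h t) \<omega> = c * I h \<omega>) \<and>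
     (\<forall>h\<in>CM_space T. (LINT \<omega>|\<mu>. (I h \<omega>)\<^sup>2) = CM_inner T h h) \<and>
     (\<forall>l\<in>path_dual T. AE \<omega> in \<mu>. I (CM_embed T l) \<omega> = l \<omega>)"

text \<open>The integrand is the derivative of the element to which \<^term>\<open>I\<close> is applied.\<close>

definition pw_integral ::
    "real set \<Rightarrow> ((real \<Rightarrow> real) \<Rightarrow> (real \<Rightarrow> real) \<Rightarrow> real) \<Rightarrow> (real \<Rightarrow> real) \<Rightarrow> (real \<Rightarrow> real) \<Rightarrow> real"
  where "pw_integral T I f = I (delta_primitive T f)"

end

theory Submission
  imports Defs
begin

text \<open>Let \<open>\<sigma>\<close> be the forward jump, so that \<open>t + \<mu>(t) = \<sigma>(t) \<in> T\<close>. The right-hand side is \<open>l(\<omega>)\<close> for the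
  continuous functional \<open>l(\<omega>) = \<omega>(\<sigma>(t)) - \<omega>(\<sigma>(s))\<close>, so it suffices that \<open>l\<close> is represented in the
  Cameron-Martin space by the primitive of the indicator of \<open>]s,t]\<close>. Up to a null set of the
  delta measure, \<open>[0,\<sigma>(x)[\<close> and \<open>[0,x]\<close> agree on \<open>T\<close>; hence \<open>h(\<sigma>(x))\<close> is the integral of the
  derivative of \<open>h\<close> over \<open>[0,x]\<close>, and \<open>l(h)\<close> is its integral over \<open>]s,t]\<close>. The same identity shows
  that the derivative is determined almost everywhere by \<open>h\<close>.\<close>

section \<open>Integrals determined by half-lines; square-integrable functions\<close>

text \<open>Dynkin's argument: the half-lines are stable under intersection and generate the Borel
  sets, and vanishing of the integral passes to complements (as the total is 0) and to countable
  disjoint unions. Measurability of the identity only asks that traces of Borel sets on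
  \<open>space N\<close> are measurable, which suits a measure living on \<open>T\<close>.\<close>

lemma set_integral_eq_0_if_atMost:
  fixes f :: "real \<Rightarrow> real"
  assumes f: "integrable N f" and N: "(\<lambda>u. u) \<in> borel_measurable N"
    and total: "(LINT u|N. f u) = 0" and atMost: "\<And>x. (LINT u:{..x}|N. f u) = 0"
    and A: "A \<in> sets borel"
  shows "(LINT u:A|N. f u) = 0"
proof -
  have sets: "space N \<inter> A \<in> sets N" if "A \<in> sets borel" for A
    using measurable_sets[OF N that] by (simp add: Int_commute)
  have int: "integrable N (\<lambda>u. indicator A u * f u)" if "A \<in> sets borel" for A
  proof -
    have "integrable N (\<lambda>u. indicator (space N \<inter> A) u *\<^sub>R f u)"
      using sets[OF that] f by (rule integrable_mult_indicator)
    also have "?this \<longleftrightarrow> ?thesis"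
      by (rule Bochner_Integration.integrable_cong) (auto simp: indicator_def)
    finally show ?thesis .
  qed
  have "Int_stable (range (atMost :: real \<Rightarrow> real set))"
    by (auto simp: Int_stable_def)
  moreover have "range (atMost :: real \<Rightarrow> real set) \<subseteq> Pow UNIV"
    by simp
  moreover have "A \<in> sigma_sets UNIV (range atMost)"
    using A by (simp add: borel_eq_atMost)
  ultimately show ?thesis
  proof (induction rule: sigma_sets_induct_disjoint)
    case (basic A)
    then show ?case using atMost by auto
  next
    case empty
    then show ?case by (simp add: set_lebesgue_integral_def)
  next
    case (compl A)
    then have "A \<in> sets borel"
      by (simp add: borel_eq_atMost)
    have "(LINT u:UNIV - A|N. f u) = (LINT u|N. f u - indicator A u * f u)"
      unfolding set_lebesgue_integral_def
      by (rule Bochner_Integration.integral_cong) (auto simp: indicator_def)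
    also have "\<dots> = 0"
      using compl.IH total f int[OF \<open>A \<in> sets borel\<close>]
      by (simp add: set_lebesgue_integral_def)
    finally show ?case .
  next
    case (union A)
    \<comment> \<open>Countable additivity needs members of \<open>sets N\<close>; the traces
      \<open>A' i\<close> are such, and carry the same integrals as the sets
      \<open>A i\<close>.\<close>
    define A' where "A' i = space N \<inter> A i" for i
    have "A i \<in> sets borel" for i
      using union by (simp add: borel_eq_atMost image_subset_iff)
    then have A': "A' i \<in> sets N" for i
      using sets by (simp add: A'_def)
    have eq: "(LINT u:space N \<inter> B|N. f u) = (LINT u:B|N. f u)" for B
      unfolding set_lebesgue_integral_def
      by (rule Bochner_Integration.integral_cong) (auto simp: indicator_def)
    have "(LINT u:(\<Union>i. A' i)|N. f u) = (\<Sum>i. (LINT u:A' i|N. f u))"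
    proof (rule lebesgue_integral_countable_add)
      show "A' i \<inter> A' j = {}" if "i \<noteq> j" for i j
        using union that by (auto simp: A'_def disjoint_family_on_def)
      have "(\<Union>i. A' i) \<in> sets N"
        using A' by auto
      then show "set_integrable N (\<Union>i. A' i) f"
        using f unfolding set_integrable_def by (rule integrable_mult_indicator)
    qed (use A' in auto)
    also have "\<dots> = 0"
      using union.IH by (simp add: A'_def eq)
    also have "(\<Union>i. A' i) = space N \<inter> (\<Union>i. A i)"
      by (auto simp: A'_def)
    finally show ?case by (simp only: eq)
  qed
qed

lemma integrable_L2:
  assumes "finite_measure N" and "f \<in> L2 N"
  shows "integrable N f"
proof (rule finite_measure.square_integrable_imp_integrable)
  show "f \<in> borel_measurable N" "integrable N (\<lambda>x. (f x)\<^sup>2)"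
    using assms(2) by (simp_all add: L2_def)
qed fact

lemma integrable_mult_L2:
  assumes "f \<in> L2 N" and "g \<in> L2 N"
  shows "integrable N (\<lambda>x. f x * g x)"
proof (rule Bochner_Integration.integrable_bound)
  show "integrable N (\<lambda>x. (f x)\<^sup>2 + (g x)\<^sup>2)"
    using assms by (simp add: L2_def)
  show "(\<lambda>x. f x * g x) \<in> borel_measurable N"
    using assms by (auto simp: L2_def intro: borel_measurable_times)
  have "\<bar>f x * g x\<bar> \<le> (f x)\<^sup>2 + (g x)\<^sup>2" for x
    using sum_squares_bound[of "f x" "g x"] sum_squares_bound[of "f x" "- g x"]
    by (simp add: abs_le_iff)
  then show "AE x in N. norm (f x * g x) \<le> norm ((f x)\<^sup>2 + (g x)\<^sup>2)"
    by simp
qed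

section \<open>Forward and backward jumps of a time scale\<close>

locale time_scale =
  fixes T :: "real set"
  assumes closed: "closed T" and endpoints: "{0, 1} \<subseteq> T" and subset: "T \<subseteq> {0..1}"
begin

lemma fwd_jump_mem: "fwd_jump T x \<in> T"
proof (cases "x < 1")
  case True
  have "bdd_below {u \<in> T. x < u}"
    by (rule bdd_belowI[of _ x]) auto
  then have "Inf {u \<in> T. x < u} \<in> T"
    using True endpoints closed by (intro closed_subset_contains_Inf) auto
  then show ?thesis using True by (simp add: fwd_jump_def)
qed (use endpoints in \<open>auto simp: fwd_jump_def\<close>)

lemma fwd_jump_le:
  assumes "v \<in> T" "x < v"
  shows "fwd_jump T x \<le> v"
proof -
  have "bdd_below {u \<in> T. x < u}"
    by (rule bdd_belowI[of _ x]) auto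
  then have "Inf {u \<in> T. x < u} \<le> v"
    using assms by (intro cInf_lower) auto
  moreover have "v \<le> 1"
    using assms subset by auto
  ultimately show ?thesis
    using assms by (simp add: fwd_jump_def)
qed

lemma fwd_jump_ge: "x \<le> 1 \<Longrightarrow> x \<le> fwd_jump T x"
  using endpoints cInf_greatest[of "{u \<in> T. x < u}" x] by (auto simp: fwd_jump_def)

lemma bwd_jump_mem: "bwd_jump T x \<in> T"
proof (cases "0 < x")
  case True
  have "bdd_above {u \<in> T. u < x}"
    by (rule bdd_aboveI[of _ x]) auto
  then have "Sup {u \<in> T. u < x} \<in> T"
    using True endpoints closed by (intro closed_subset_contains_Sup) auto
  then show ?thesis using True by (simp add: bwd_jump_def)
qed (use endpoints in \<open>auto simp: bwd_jump_def\<close>)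

lemma bwd_jump_ge:
  assumes "v \<in> T" "v < x"
  shows "v \<le> bwd_jump T x"
proof -
  have "bdd_above {u \<in> T. u < x}"
    by (rule bdd_aboveI[of _ x]) auto
  then have "v \<le> Sup {u \<in> T. u < x}"
    using assms by (intro cSup_upper) auto
  moreover have "0 \<le> v"
    using assms subset by auto
  ultimately show ?thesis
    using assms by (simp add: bwd_jump_def)
qed

lemma bwd_jump_le: "0 \<le> x \<Longrightarrow> bwd_jump T x \<le> x"
  using endpoints cSup_least[of "{u \<in> T. u < x}" x] by (auto simp: bwd_jump_def)

section \<open>The delta measure\<close>

lemma measurable_bwd_jump [measurable]:
  "bwd_jump T \<in> restrict_space lborel {0..1} \<rightarrow>\<^sub>M restrict_space borel T"
proof (rule measurable_restrict_space2)
  \<comment> \<open>Monotone functions are Borel. For \<open>x < y\<close>, the point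
    \<open>bwd_jump T x\<close> of \<open>T\<close> lies below \<open>y\<close>, hence is at most
    \<open>bwd_jump T y\<close>.\<close>
  have "mono_on {0..1} (bwd_jump T)"
  proof (rule mono_onI)
    fix x y :: real
    assume "x \<in> {0..1}" "y \<in> {0..1}" "x \<le> y"
    then show "bwd_jump T x \<le> bwd_jump T y"
      using bwd_jump_le[of x] bwd_jump_ge[OF bwd_jump_mem, of x y]
      by (cases "x = y") auto
  qed
  then have "bwd_jump T \<in> borel_measurable (restrict_space borel {0..1})"
    by (rule borel_measurable_mono_on_fnc)
  then show "bwd_jump T \<in> borel_measurable (restrict_space lborel {0..1})"
    by (simp cong: measurable_cong_sets add: sets_restrict_space_cong[OF sets_lborel])
qed (auto simp: bwd_jump_mem)

lemma space_delta_measure [simp]: "space (delta_measure T) = T"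
  by (simp add: delta_measure_def space_restrict_space)

lemma sets_delta_measure [simp, measurable_cong]:
  "sets (delta_measure T) = sets (restrict_space borel T)"
  by (simp add: delta_measure_def)

lemma sets_delta_measureI: "A \<in> sets borel \<Longrightarrow> A \<inter> T \<in> sets (delta_measure T)"
  by (auto simp: sets_restrict_space)

lemma emeasure_delta_measure:
  assumes "A \<in> sets borel"
  shows "emeasure (delta_measure T) (A \<inter> T) =
    emeasure (restrict_space lborel {0..1}) {u \<in> {0..1}. bwd_jump T u \<in> A}"
proof -
  have "A \<inter> T \<in> sets (restrict_space borel T)"
    using assms by (auto simp: sets_restrict_space)
  moreover have "bwd_jump T -` (A \<inter> T) \<inter> {0..1} = {u \<in> {0..1}. bwd_jump T u \<in> A}"
    using bwd_jump_mem by auto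
  ultimately show ?thesis
    by (simp add: delta_measure_def emeasure_distr space_restrict_space)
qed

text \<open>Reduces upper bounds for the delta measure to locating the points that
  \<open>bwd_jump T\<close> sends into \<open>A\<close>. The interval estimate, finiteness and the
  null points below all follow this pattern.\<close>

lemma emeasure_delta_measure_le:
  assumes "A \<in> sets borel" "C \<in> sets borel"
    and "\<And>u. u \<in> {0..1} \<Longrightarrow> bwd_jump T u \<in> A \<Longrightarrow> u \<in> C"
  shows "emeasure (delta_measure T) (A \<inter> T) \<le> emeasure lborel C"
proof -
  have "{u \<in> {0..1}. bwd_jump T u \<in> A} \<subseteq> C \<inter> {0..1}"
    using assms by auto
  then have "emeasure (delta_measure T) (A \<inter> T) \<le>
      emeasure (restrict_space lborel {0..1}) (C \<inter> {0..1})"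
    unfolding emeasure_delta_measure[OF assms(1)]
    using assms by (intro emeasure_mono) (auto simp: sets_restrict_space)
  also have "\<dots> = emeasure lborel (C \<inter> {0..1})"
    by (rule emeasure_restrict_space) auto
  also have "\<dots> \<le> emeasure lborel C"
    using assms by (intro emeasure_mono) auto
  finally show ?thesis .
qed

lemma emeasure_delta_measure_interval:
  assumes "a \<in> T" "b \<in> T" "a \<le> b"
  shows "emeasure (delta_measure T) ({a..<b} \<inter> T) \<le> ennreal (b - a)"
proof -
  have "emeasure (delta_measure T) ({a..<b} \<inter> T) \<le> emeasure lborel {a..b}"
  proof (rule emeasure_delta_measure_le)
    \<comment> \<open>If \<open>u > b\<close>, then \<open>b\<close>, being in \<open>T\<close>,
      would give \<open>bwd_jump T u \<ge> b\<close>.\<close>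
    fix u assume "u \<in> {0..1}" "bwd_jump T u \<in> {a..<b}"
    then show "u \<in> {a..b}"
      using bwd_jump_le[of u] bwd_jump_ge[OF \<open>b \<in> T\<close>, of u] by (cases "b < u") auto
  qed auto
  then show ?thesis using assms by simp
qed

sublocale finite_measure "delta_measure T"
proof
  have "emeasure (delta_measure T) (UNIV \<inter> T) \<le> emeasure lborel {0..1::real}"
    by (rule emeasure_delta_measure_le) auto
  then show "emeasure (delta_measure T) (space (delta_measure T)) \<noteq> \<infinity>"
    by (auto simp: top_unique)
qed

text \<open>The point \<open>x\<close> itself is the only obstruction. If \<open>x\<close> is right-scattered, then it lies on both
  sides of the equivalence; if it is right-dense, it has measure zero.\<close>

lemma AE_less_fwd_jump_iff:
  assumes "x \<le> 1"
  shows "AE v in delta_measure T. v < fwd_jump T x \<longleftrightarrow> v \<le> x"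
proof (cases "fwd_jump T x = x")
  case False
  then have "x < fwd_jump T x"
    using fwd_jump_ge[OF assms] by simp
  then show ?thesis
    using fwd_jump_le[of _ x] by (intro AE_I2) force
next
  case True
  have "emeasure (delta_measure T) ({x} \<inter> T) \<le> emeasure lborel {x}"
  proof (rule emeasure_delta_measure_le)
    \<comment> \<open>If \<open>u\<close> were larger than \<open>x\<close>, right-density would
      yield a point of \<open>T\<close> strictly between them, which pushes
      \<open>bwd_jump T u\<close> above \<open>x\<close>. So only \<open>u = x\<close> is sent to
      \<open>x\<close>.\<close>
    fix u assume u: "u \<in> {0..1}" "bwd_jump T u \<in> {x}"
    then have "x \<le> u" using bwd_jump_le[of u] by auto
    moreover have "\<not> x < u"
    proof
      assume "x < u"
      then have "x < 1" using u by simp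
      then have "Inf {v \<in> T. x < v} < u"
        using True \<open>x < u\<close> by (simp add: fwd_jump_def)
      then obtain v where "v \<in> T" "x < v" "v < u"
        using endpoints \<open>x < 1\<close> by (subst (asm) cInf_less_iff) (auto intro!: bdd_belowI[of _ x])
      then show False using u bwd_jump_ge[of v u] by auto
    qed
    ultimately show "u \<in> {x}" by simp
  qed auto
  then have "{x} \<inter> T \<in> null_sets (delta_measure T)"
    by (auto intro!: null_setsI sets_delta_measureI simp del: sets_delta_measure)
  from AE_not_in[OF this] AE_space show ?thesis
    by eventually_elim (use True fwd_jump_mem[of x] in auto)
qed

section \<open>Primitives for the delta measure\<close>

text \<open>Here \<open>x\<close> may lie outside \<open>T\<close>, because
  \<open>fwd_jump T x\<close> is in \<open>T\<close> anyway. Hence a primitive encodes the integrals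
  over all half-lines ending at or before 1, as uniqueness of derivatives requires.\<close>

lemma delta_primitive_fwd_jump:
  assumes "x \<le> 1" and [measurable]: "f \<in> borel_measurable (delta_measure T)"
  shows "delta_primitive T f (fwd_jump T x) = (LINT u:{..x} \<inter> T|delta_measure T. f u)"
proof -
  have "AE u in delta_measure T. u \<in> T"
    by (rule AE_I2) simp
  with AE_less_fwd_jump_iff[OF assms(1)]
  have "AE u in delta_measure T. u \<in> {0..<fwd_jump T x} \<inter> T \<longleftrightarrow> u \<in> {..x} \<inter> T"
    by eventually_elim (use subset in auto)
  then have "(LINT u:{0..<fwd_jump T x} \<inter> T|delta_measure T. f u) =
      (LINT u:{..x} \<inter> T|delta_measure T. f u)"
    unfolding set_lebesgue_integral_def
    by (intro integral_cong_AE borel_measurable_scaleR borel_measurable_indicator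
        sets_delta_measureI assms) (auto elim!: eventually_mono simp: indicator_def)
  then show ?thesis
    by (simp add: delta_primitive_def fwd_jump_mem)
qed

text \<open>Equal primitives give \<open>f - g\<close> integral 0 over every half-line, hence over
  every Borel set, which forces equality almost everywhere. This controls the arbitrary choice made
  in \<open>delta_deriv\<close>.\<close>

lemma delta_primitive_inj:
  assumes f: "integrable (delta_measure T) f" and g: "integrable (delta_measure T) g"
    and eq: "delta_primitive T f = delta_primitive T g"
  shows "AE u in delta_measure T. f u = g u"
proof -
  let ?N = "delta_measure T"
  \<comment> \<open>Integrals see only the part of a set inside \<open>T\<close>, while
    measurability rules need the trace on \<open>T\<close>; this passes between the two.\<close>
  have T_eq: "(LINT u:A \<inter> T|?N. h u) = (LINT u:A|?N. h u)" for A and h :: "real \<Rightarrow> real"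
    unfolding set_lebesgue_integral_def
    by (rule Bochner_Integration.integral_cong) (auto simp: indicator_def)
  have int: "set_integrable ?N (A \<inter> T) h" if "integrable ?N h" "A \<in> sets borel"
    for A and h :: "real \<Rightarrow> real"
    unfolding set_integrable_def
    using sets_delta_measureI[OF that(2)] that(1) by (rule integrable_mult_indicator)
  have diff: "(LINT u:A|?N. f u - g u) = (LINT u:A|?N. f u) - (LINT u:A|?N. g u)"
    if "A \<in> sets borel" for A
    using set_integral_diff(2)[OF int[OF f that] int[OF g that]] by (simp add: T_eq)
  have le1: "(LINT u:{..x}|?N. f u - g u) = 0" if "x \<le> 1" for x
    using delta_primitive_fwd_jump[OF that, of f] delta_primitive_fwd_jump[OF that, of g] eq f g
    by (simp add: diff T_eq)
  \<comment> \<open>Half-lines ending at or beyond 1 contain \<open>T\<close>, so their integrals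
    are the total one, which is 0 by the case \<open>x = 1\<close>.\<close>
  have ge1: "(LINT u|?N. f u - g u) = (LINT u:{..x}|?N. f u - g u)" if "1 \<le> x" for x
    unfolding set_lebesgue_integral_def
    by (rule Bochner_Integration.integral_cong) (use subset that in \<open>auto simp: indicator_def\<close>)
  have total: "(LINT u|?N. f u - g u) = 0"
    using ge1[of 1] le1[of 1] by simp
  have zero: "(LINT u:A|?N. f u - g u) = 0" if "A \<in> sets borel" for A
  proof (rule set_integral_eq_0_if_atMost)
    show "(LINT u:{..x}|?N. f u - g u) = 0" for x
      using le1[of x] ge1[of x] total by (cases "x \<le> 1") auto
    show "(\<lambda>u. u) \<in> borel_measurable ?N"
      unfolding measurable_cong_sets[OF sets_delta_measure refl]
      by (rule measurable_restrict_space1) simp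
  qed (use f g total that in auto)
  show ?thesis
  proof (rule density_unique_real[OF f g])
    fix A assume "A \<in> sets ?N"
    then obtain A' where "A' \<in> sets borel" "A = A' \<inter> T"
      by (auto simp: sets_restrict_space)
    then show "(LINT u:A|?N. f u) = (LINT u:A|?N. g u)"
      using zero[of A'] diff[of A'] by (simp add: T_eq)
  qed
qed

text \<open>Such a primitive is 1-Lipschitz: its increment from \<open>a\<close> to \<open>b\<close>
  integrates a function bounded by 1 over a set of delta measure at most
  \<open>b - a\<close>.\<close>

lemma continuous_on_delta_primitive:
  assumes [measurable]: "f \<in> borel_measurable (delta_measure T)" and le: "\<And>u. \<bar>f u\<bar> \<le> 1"
  shows "continuous_on T (delta_primitive T f)"
proof -
  let ?N = "delta_measure T"
  have int: "set_integrable ?N (A \<inter> T) f" if "A \<in> sets borel" for A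
    unfolding set_integrable_def using le
    by (intro integrable_mult_indicator sets_delta_measureI that integrable_const_bound[of _ 1]) auto
  have *: "\<bar>delta_primitive T f b - delta_primitive T f a\<bar> \<le> b - a"
    if ab: "a \<in> T" "b \<in> T" "a \<le> b" for a b
  proof -
    have "{0..<b} \<inter> T = ({0..<a} \<inter> T) \<union> ({a..<b} \<inter> T)"
      using ab subset by auto
    moreover have "(LINT u:({0..<a} \<inter> T) \<union> ({a..<b} \<inter> T)|?N. f u) =
        (LINT u:{0..<a} \<inter> T|?N. f u) + (LINT u:{a..<b} \<inter> T|?N. f u)"
      by (intro set_integral_Un int) auto
    ultimately have "delta_primitive T f b - delta_primitive T f a = (LINT u:{a..<b} \<inter> T|?N. f u)"
      using ab by (simp add: delta_primitive_def)
    also have "\<bar>\<dots>\<bar> \<le> (LINT u|?N. indicator ({a..<b} \<inter> T) u)"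
      unfolding set_lebesgue_integral_def
      unfolding real_norm_def[symmetric]
    proof (rule Bochner_Integration.integral_norm_bound_integral)
      show "integrable ?N (\<lambda>u. indicator ({a..<b} \<inter> T) u *\<^sub>R f u)"
        using int[of "{a..<b}"] by (simp add: set_integrable_def)
      show "integrable ?N (indicator ({a..<b} \<inter> T) :: real \<Rightarrow> real)"
        by (intro integrable_real_indicator sets_delta_measureI) (auto simp: less_top[symmetric])
    qed (use le in \<open>auto simp: indicator_def\<close>)
    also have "\<dots> = measure ?N ({a..<b} \<inter> T)"
      using subset by (simp add: Int_absorb2)
    also have "\<dots> \<le> b - a"
      using emeasure_delta_measure_interval[OF ab] ab
      by (simp add: measure_def enn2real_leI)
    finally show ?thesis .
  qed
  have "1-lipschitz_on T (delta_primitive T f)"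
  proof (rule lipschitz_onI)
    show "dist (delta_primitive T f a) (delta_primitive T f b) \<le> 1 * dist a b"
      if "a \<in> T" "b \<in> T" for a b
      using *[of a b] *[of b a] that by (cases "a \<le> b") (auto simp: dist_real_def)
  qed simp
  then show ?thesis by (rule lipschitz_on_continuous_on)
qed

section \<open>The Cameron-Martin space and its inner product\<close>

lemma delta_deriv:
  assumes "h \<in> CM_space T"
  shows "delta_deriv T h \<in> L2 (delta_measure T)"
    and "delta_primitive T (delta_deriv T h) = h"
proof -
  have "\<exists>f. f \<in> L2 (delta_measure T) \<and> h = delta_primitive T f"
    using assms by (auto simp: CM_space_def)
  from someI_ex[OF this] show "delta_deriv T h \<in> L2 (delta_measure T)"
    "delta_primitive T (delta_deriv T h) = h"
    by (simp_all add: delta_deriv_def)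
qed

lemma delta_primitive_cong_AE:
  assumes "f \<in> borel_measurable (delta_measure T)" "g \<in> borel_measurable (delta_measure T)"
    and "AE u in delta_measure T. f u = g u"
  shows "delta_primitive T f = delta_primitive T g"
proof -
  have "(LINT u:{0..<t} \<inter> T|delta_measure T. f u) = (LINT u:{0..<t} \<inter> T|delta_measure T. g u)" for t
    using assms by (intro set_lebesgue_integral_cong_AE sets_delta_measureI) auto
  then show ?thesis
    by (simp add: delta_primitive_def fun_eq_iff)
qed

text \<open>Testing with \<open>g\<close> and \<open>g'\<close> makes the squared distance of their
  chosen derivatives integrate to 0, without ever differentiating \<open>g - g'\<close>. This
  supplies the uniqueness behind the definite description in \<open>CM_embed\<close>.\<close>

lemma CM_inner_inj:
  assumes g: "g \<in> CM_space T" and g': "g' \<in> CM_space T"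
    and eq: "\<And>h. h \<in> CM_space T \<Longrightarrow> CM_inner T g h = CM_inner T g' h"
  shows "g = g'"
proof -
  let ?N = "delta_measure T"
  define f where "f = delta_deriv T g"
  define f' where "f' = delta_deriv T g'"
  have L2: "f \<in> L2 ?N" "f' \<in> L2 ?N"
    unfolding f_def f'_def using delta_deriv(1) g g' by auto
  note int = integrable_mult_L2[OF L2(1) L2(1)] integrable_mult_L2[OF L2(1) L2(2)]
    integrable_mult_L2[OF L2(2) L2(1)] integrable_mult_L2[OF L2(2) L2(2)]
  have expand: "(f u - f' u)\<^sup>2 = (f u * f u - f u * f' u) - (f' u * f u - f' u * f' u)" for u
    by (simp add: power2_eq_square algebra_simps)
  have "(LINT u|?N. (f u - f' u)\<^sup>2) = 0"
    using eq[OF g] eq[OF g'] int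
    unfolding expand CM_inner_def f_def[symmetric] f'_def[symmetric]
    by (simp add: mult.commute[of "f' _" "f _"])
  moreover have "integrable ?N (\<lambda>u. (f u - f' u)\<^sup>2)"
    unfolding expand using int by simp
  ultimately have "AE u in ?N. (f u - f' u)\<^sup>2 = 0"
    by (subst (asm) integral_nonneg_eq_0_iff_AE) auto
  then have "AE u in ?N. f u = f' u"
    by simp
  then have "delta_primitive T f = delta_primitive T f'"
    using L2 by (intro delta_primitive_cong_AE) (auto simp: L2_def)
  then show ?thesis
    using delta_deriv(2) g g' by (simp add: f_def f'_def)
qed

lemma indicator_in_L2: "indicator {s<..t} \<in> L2 (delta_measure T)"
proof -
  have "indicator {s<..t} \<in> borel_measurable (restrict_space borel T)"
    by (rule measurable_restrict_space1) simp
  then have [measurable]: "indicator {s<..t} \<in> borel_measurable (delta_measure T)"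
    by (simp cong: measurable_cong_sets)
  have "integrable (delta_measure T) (\<lambda>u. (indicator {s<..t} u :: real)\<^sup>2)"
    by (rule integrable_const_bound[of _ 1]) (auto intro!: AE_I2 split: split_indicator)
  then show ?thesis
    by (simp add: L2_def)
qed

lemma delta_primitive_indicator_in_CM_space:
  "delta_primitive T (indicator {s<..t}) \<in> CM_space T"
proof -
  have "continuous_on T (delta_primitive T (indicator {s<..t}))"
    using indicator_in_L2[of s t]
    by (intro continuous_on_delta_primitive) (auto simp: L2_def indicator_def)
  \<comment> \<open>The value at 0 is an integral over an empty set; off \<open>T\<close> the
    primitive is 0 by convention.\<close>
  then show ?thesis
    using indicator_in_L2[of s t]
    by (auto simp: CM_space_def path_space_def) (simp_all add: delta_primitive_def set_lebesgue_integral_def)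
qed

lemma CM_inner_indicator:
  assumes h: "h \<in> CM_space T" and "s \<le> t" "t \<le> 1"
  shows "CM_inner T (delta_primitive T (indicator {s<..t})) h =
    h (fwd_jump T t) - h (fwd_jump T s)"
proof -
  let ?N = "delta_measure T" and ?g = "delta_primitive T (indicator {s<..t})"
  define f where "f = delta_deriv T h"
  have f: "f \<in> L2 ?N" and h_eq: "h = delta_primitive T f"
    using delta_deriv[OF h] by (simp_all add: f_def)
  note g = delta_deriv[OF delta_primitive_indicator_in_CM_space[of s t]]
  have fN: "integrable ?N f" using integrable_L2[OF finite_measure_axioms f] .
  have int: "integrable ?N (\<lambda>u. indicator ({..x} \<inter> T) u *\<^sub>R f u)" for x
    using fN by (intro integrable_mult_indicator sets_delta_measureI) auto
  \<comment> \<open>\<open>delta_deriv\<close> selects some derivative of \<open>?g\<close>; it need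
    only agree with the indicator almost everywhere to be replaced under the integral.\<close>
  have "AE u in ?N. delta_deriv T ?g u = indicator {s<..t} u"
    using g indicator_in_L2 by (intro delta_primitive_inj integrable_L2 finite_measure_axioms) auto
  then have "CM_inner T ?g h = (LINT u|?N. indicator {s<..t} u * f u)"
    unfolding CM_inner_def f_def[symmetric]
    using g(1) f indicator_in_L2[of s t] by (intro integral_cong_AE) (auto simp: L2_def)
  \<comment> \<open>As \<open>s \<le> t\<close>, the interval is a difference of two half-lines, and
    each half-line integral of \<open>f\<close> is a value of \<open>h\<close> at a forward
    jump.\<close>
  also have "\<dots> = (LINT u|?N. indicator ({..t} \<inter> T) u *\<^sub>R f u - indicator ({..s} \<inter> T) u *\<^sub>R f u)"
    using assms by (intro Bochner_Integration.integral_cong) (auto simp: indicator_def)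
  also have "\<dots> = h (fwd_jump T t) - h (fwd_jump T s)"
    using int fN assms
    by (simp add: h_eq delta_primitive_fwd_jump set_lebesgue_integral_def)
  finally show ?thesis .
qed

text \<open>The representing element is exhibited explicitly: \<open>CM_inner_indicator\<close>
  shows that it represents the functional, \<open>CM_inner_inj\<close> that nothing else
  does.\<close>

lemma CM_embed_eval_diff:
  assumes "s \<le> t" "t \<le> 1"
  shows "CM_embed T (\<lambda>\<omega>. \<omega> (fwd_jump T t) - \<omega> (fwd_jump T s)) =
    delta_primitive T (indicator {s<..t})"
  unfolding CM_embed_def
proof (rule the_equality)
  fix g
  assume "g \<in> CM_space T \<and>
    (\<forall>h\<in>CM_space T. CM_inner T g h = h (fwd_jump T t) - h (fwd_jump T s))"
  then show "g = delta_primitive T (indicator {s<..t})"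
    using assms
    by (intro CM_inner_inj) (simp_all add: CM_inner_indicator delta_primitive_indicator_in_CM_space)
qed (simp add: CM_inner_indicator delta_primitive_indicator_in_CM_space assms)

section \<open>Evaluation functionals and the integral of the indicator\<close>

text \<open>A real supremum bounds its members only over a bounded set; compactness of
  \<open>T\<close> and continuity of the path provide this.\<close>

lemma abs_le_sup_norm:
  assumes "\<omega> \<in> path_space T" and "a \<in> T"
  shows "\<bar>\<omega> a\<bar> \<le> sup_norm T \<omega>"
proof -
  have "compact T"
    using closed subset compact_Icc[of 0 "1::real"] by (metis compact_Int_closed inf.absorb2)
  then have "bounded ((\<lambda>u. \<bar>\<omega> u\<bar>) ` T)"
    using assms by (intro compact_imp_bounded compact_continuous_image continuous_intros)
      (auto simp: path_space_def)
  then show ?thesis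
    unfolding sup_norm_def using assms by (intro cSUP_upper bounded_imp_bdd_above)
qed

lemma eval_diff_in_path_dual:
  assumes "a \<in> T" "b \<in> T"
  shows "(\<lambda>\<omega>. \<omega> b - \<omega> a) \<in> path_dual T"
proof -
  have "\<bar>\<omega> b - \<omega> a\<bar> \<le> 2 * sup_norm T \<omega>" if "\<omega> \<in> path_space T" for \<omega>
    using abs_le_sup_norm[OF that assms(1)] abs_le_sup_norm[OF that assms(2)] by linarith
  then have "\<exists>K. \<forall>\<omega>\<in>path_space T. \<bar>\<omega> b - \<omega> a\<bar> \<le> K * sup_norm T \<omega>"
    by blast
  then show ?thesis
    unfolding path_dual_def by (simp add: algebra_simps)
qed

end

theorem proposition3p3:
  fixes T :: "real set" and s t :: real
    and M :: "'a measure" and B :: "real \<Rightarrow> 'a \<Rightarrow> real"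
    and I :: "(real \<Rightarrow> real) \<Rightarrow> (real \<Rightarrow> real) \<Rightarrow> real"
  assumes "closed T" and "{0, 1} \<subseteq> T" and "T \<subseteq> {0..1}"
    and "standard_brownian_motion M B"
    and "paley_wiener T (path_law T M B) I"
    and "s \<in> T" and "t \<in> T" and "s \<le> t"
  shows "AE \<omega> in path_law T M B.
           pw_integral T I (indicator {s<..t}) \<omega>
             = W (t + graininess T t) \<omega> - W (s + graininess T s) \<omega>"
proof -
  interpret time_scale T
    using assms by unfold_locales
  \<comment> \<open>On the range of \<open>CM_embed\<close> the Paley-Wiener integral is the
    functional itself, so no limit has to be taken.\<close>
  have "AE \<omega> in path_law T M B. I (CM_embed T l) \<omega> = l \<omega>" if "l \<in> path_dual T" for l
    using assms(5) that by (simp add: paley_wiener_def)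
  from this[OF eval_diff_in_path_dual[OF fwd_jump_mem[of s] fwd_jump_mem[of t]]]
  show ?thesis
    using CM_embed_eval_diff[of s t] assms(3,7,8)
    by (simp add: subset_iff pw_integral_def W_def graininess_def)
qed

end
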